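(* Let $n\ge 1$ and let $a,b,c\in\mathbb Z_n$. Then: (i) $[a]=[b]$ in $M(n)$ if and only if $a\equiv bu^2\pmod n$ for some $u\in\mathbb Z_n^\times$; (ii) $[c]\in[a]+[b]$ in $M(n)$ if and only if there are units $u,v,w\in\mathbb Z_n^\times$ such that $cw^2\equiv au^2+bv^2\pmod n$.
   Context: For a positive integer $n$, $\mathbb Z_n=\mathbb Z/n\mathbb Z$, $\mathbb Z_n^\times$ is its group of units, and $S_n=\{u^2:u\in\mathbb Z_n^\times\}$. $M(n)$ denotes the Marshall quotient of $\mathbb Z_n$ by $S_n$: the underlying set is the quotient of $\mathbb Z_n$ by the equivalence relation $a\sim b\iff as=bt$ for some $s,t\in S_n$; the class of $a$ is written $[a]$. The operations are $[a][b]=[ab]$, $-[a]=[-a]$, and the multivalued addition $[a]+[b]=\{[c]: cr=as+bt\text{ for some }r,s,t\in S_n\}$, with zero $[0]$ and unit $[1]$. *)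

theory Defs
  imports "HOL-Algebra.IntRing"
begin

record 'a multiring = "'a monoid" +
  mzero :: 'a
  mneg :: "'a \<Rightarrow> 'a"
  madd :: "'a \<Rightarrow> 'a \<Rightarrow> 'a set"

definition marshall_rel :: "('a, 'm) ring_scheme \<Rightarrow> 'a set \<Rightarrow> ('a \<times> 'a) set" where
  "marshall_rel R S =
    {(a, b) \<in> carrier R \<times> carrier R. \<exists>s\<in>S. \<exists>t\<in>S. a \<otimes>\<^bsub>R\<^esub> s = b \<otimes>\<^bsub>R\<^esub> t}"

definition marshall_class :: "('a, 'm) ring_scheme \<Rightarrow> 'a set \<Rightarrow> 'a \<Rightarrow> 'a set" where
  "marshall_class R S a = marshall_rel R S `` {a}"

(* The operations on classes are unions over representatives, as usual for quotients: when S is a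
   multiplicative set of a commutative ring, each member of such a union is independent of the
   representatives, so that the union is just that common value. *)
definition marshall_quotient :: "('a, 'm) ring_scheme \<Rightarrow> 'a set \<Rightarrow> 'a set multiring" where
  "marshall_quotient R S =
    \<lparr> carrier = carrier R // marshall_rel R S,
      monoid.mult = (\<lambda>X Y. \<Union>a\<in>X. \<Union>b\<in>Y. marshall_class R S (a \<otimes>\<^bsub>R\<^esub> b)),
      one = marshall_class R S \<one>\<^bsub>R\<^esub>,
      mzero = marshall_class R S \<zero>\<^bsub>R\<^esub>,
      mneg = (\<lambda>X. \<Union>a\<in>X. marshall_class R S (\<ominus>\<^bsub>R\<^esub> a)),
      madd = (\<lambda>X Y. \<Union>a\<in>X. \<Union>b\<in>Y.
        {marshall_class R S c | c. c \<in> carrier R \<and>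
          (\<exists>r\<in>S. \<exists>s\<in>S. \<exists>t\<in>S. c \<otimes>\<^bsub>R\<^esub> r = a \<otimes>\<^bsub>R\<^esub> s \<oplus>\<^bsub>R\<^esub> b \<otimes>\<^bsub>R\<^esub> t)}) \<rparr>"

definition unit_squares :: "('a, 'm) ring_scheme \<Rightarrow> 'a set" where
  "unit_squares R = {u [^]\<^bsub>R\<^esub> (2::nat) | u. u \<in> Units R}"

(* ZFact is used instead of residue_ring because the latter is not a ring for modulus 1:
   its unit element is always the integer 1, which is not in the carrier {0}. *)
abbreviation Zn :: "nat \<Rightarrow> int set ring" where
  "Zn n \<equiv> ZFact (int n)"

abbreviation Mclass :: "nat \<Rightarrow> int set \<Rightarrow> int set set" where
  "Mclass n \<equiv> marshall_class (Zn n) (unit_squares (Zn n))"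

abbreviation M :: "nat \<Rightarrow> int set set multiring" where
  "M n \<equiv> marshall_quotient (Zn n) (unit_squares (Zn n))"

end

theory Submission
  imports Defs
begin

text \<open>Both equivalences hold in every commutative ring \<open>R\<close> with respect to every subgroup \<open>S\<close> of its
  unit group; the squares of units are one such subgroup. As the elements of \<open>S\<close> can be divided by
  without leaving \<open>S\<close>, the relation \<open>a s = b t\<close> says that \<open>a\<close> lies in the orbit \<open>b S\<close>, so the
  classes are the orbits of \<open>S\<close> acting on \<open>R\<close> by multiplication (\<open>marshall_rel_iff\<close>,
  \<open>marshall_class_eq_iff\<close>). A sum of classes ranges over all representatives, but replacing a
  representative multiplies it by an element of \<open>S\<close>, which is absorbed by the factor from \<open>S\<close> that
  accompanies it in the equation \<open>c r = a s + b t\<close> (\<open>marshall_class_in_madd_iff\<close>).\<close>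

context cring
begin

lemma subset_Units_of_subgroup: "subgroup S (units_of R) \<Longrightarrow> S \<subseteq> Units R"
  using subgroup.subset[of S "units_of R"] by (simp add: units_of_carrier)

lemma unit_subgroup_mult:
  "\<lbrakk>subgroup S (units_of R); s \<in> S; t \<in> S\<rbrakk> \<Longrightarrow> s \<otimes> t \<in> S"
  using subgroup.m_closed[of S "units_of R"] by (simp add: units_of_mult)

lemma unit_subgroup_inv:
  "\<lbrakk>subgroup S (units_of R); s \<in> S\<rbrakk> \<Longrightarrow> inv s \<in> S"
  using subgroup.m_inv_closed[of S "units_of R" s] subset_Units_of_subgroup[of S]
  by (auto simp: units_of_inv subset_iff)

lemma unit_subgroup_one: "subgroup S (units_of R) \<Longrightarrow> \<one> \<in> S"
  using subgroup.one_closed[of S "units_of R"] by (simp add: units_of_one)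

text \<open>Squaring is an endomorphism of the unit group because multiplication is commutative, and the
  squares of units form its image.\<close>

lemma subgroup_unit_squares: "subgroup (unit_squares R) (units_of R)"
proof -
  have "group_hom (units_of R) (units_of R) (\<lambda>u. u \<otimes> u)"
    by (auto intro!: group_hom.intro group_hom_axioms.intro units_group homI
        simp: units_of_carrier units_of_mult m_ac Units_closed)
  then have "subgroup ((\<lambda>u. u \<otimes> u) ` Units R) (units_of R)"
    using group_hom.img_is_subgroup by (fastforce simp: units_of_carrier)
  moreover have "u [^] (2::nat) = u \<otimes> u" if "u \<in> Units R" for u
    using that by (simp add: numeral_2_eq_2 Units_closed)
  then have "(\<lambda>u. u \<otimes> u) ` Units R = unit_squares R"
    unfolding unit_squares_def image_def by auto metis+
  ultimately show ?thesis by simp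
qed

text \<open>Dividing \<open>a s = b t\<close> by the unit \<open>s\<close> leaves the single factor \<open>t s\<^sup>-\<^sup>1\<close> of \<open>S\<close>.\<close>

lemma marshall_rel_iff:
  assumes S: "subgroup S (units_of R)" and "a \<in> carrier R" "b \<in> carrier R"
  shows "(a, b) \<in> marshall_rel R S \<longleftrightarrow> (\<exists>s\<in>S. a = b \<otimes> s)"
proof
  assume "(a, b) \<in> marshall_rel R S"
  then obtain s t where st: "s \<in> S" "t \<in> S" and eq: "a \<otimes> s = b \<otimes> t"
    by (auto simp: marshall_rel_def)
  have u: "s \<in> Units R" "t \<in> carrier R"
    using st subset_Units_of_subgroup[OF S] by auto
  have "a = a \<otimes> s \<otimes> inv s"
    using u assms by (simp add: m_assoc Units_closed)
  also have "\<dots> = b \<otimes> (t \<otimes> inv s)"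
    using u assms by (simp add: eq m_assoc)
  finally show "\<exists>s\<in>S. a = b \<otimes> s"
    using st unit_subgroup_mult[OF S] unit_subgroup_inv[OF S] by blast
next
  assume "\<exists>s\<in>S. a = b \<otimes> s"
  then show "(a, b) \<in> marshall_rel R S"
    using assms unit_subgroup_one[OF S] by (force simp: marshall_rel_def)
qed

lemma equiv_marshall_rel:
  assumes S: "subgroup S (units_of R)"
  shows "equiv (carrier R) (marshall_rel R S)"
proof (rule equivI)
  show "marshall_rel R S \<subseteq> carrier R \<times> carrier R"
    by (auto simp: marshall_rel_def)
  show "refl_on (carrier R) (marshall_rel R S)"
    using unit_subgroup_one[OF S] by (auto simp: refl_on_def marshall_rel_def)
  show "sym (marshall_rel R S)"
    unfolding sym_def marshall_rel_def by (auto; metis)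
  show "trans (marshall_rel R S)"
  proof (rule transI)
    fix x y z assume xy: "(x, y) \<in> marshall_rel R S" and yz: "(y, z) \<in> marshall_rel R S"
    then have c: "x \<in> carrier R" "y \<in> carrier R" "z \<in> carrier R"
      by (auto simp: marshall_rel_def)
    obtain s t where st: "s \<in> S" "x = y \<otimes> s" "t \<in> S" "y = z \<otimes> t"
      using xy yz c S by (auto simp: marshall_rel_iff)
    then have "x = z \<otimes> (t \<otimes> s)"
      using c subset_Units_of_subgroup[OF S] by (auto simp: m_assoc Units_closed subset_iff)
    then show "(x, z) \<in> marshall_rel R S"
      using c st S unit_subgroup_mult[OF S] by (auto simp: marshall_rel_iff)
  qed
qed

lemma marshall_class_eq_iff:
  assumes "subgroup S (units_of R)" "a \<in> carrier R" "b \<in> carrier R"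
  shows "marshall_class R S a = marshall_class R S b \<longleftrightarrow> (\<exists>s\<in>S. a = b \<otimes> s)"
  using assms equiv_marshall_rel[OF assms(1)]
  by (simp add: marshall_class_def eq_equiv_class_iff marshall_rel_iff)

lemma mem_marshall_class_iff:
  assumes "subgroup S (units_of R)" "a \<in> carrier R"
  shows "x \<in> marshall_class R S a \<longleftrightarrow> x \<in> carrier R \<and> (\<exists>s\<in>S. x = a \<otimes> s)"
proof -
  have "x \<in> marshall_class R S a \<longleftrightarrow> (x, a) \<in> marshall_rel R S"
    using equiv_marshall_rel[OF assms(1)]
    by (auto simp: marshall_class_def equiv_def dest: symD)
  moreover have "(x, a) \<in> marshall_rel R S \<Longrightarrow> x \<in> carrier R"
    by (simp add: marshall_rel_def)
  ultimately show ?thesis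
    using assms by (auto simp: marshall_rel_iff)
qed

text \<open>Membership in a sum of classes first yields an equation for some representatives
  \<open>a x\<close>, \<open>b y\<close>, \<open>c z\<close> with \<open>x, y, z\<close> in \<open>S\<close>; these factors merge with the coefficients.\<close>

lemma marshall_class_in_madd_iff:
  assumes S: "subgroup S (units_of R)"
    and abc: "a \<in> carrier R" "b \<in> carrier R" "c \<in> carrier R"
  shows "marshall_class R S c
           \<in> madd (marshall_quotient R S) (marshall_class R S a) (marshall_class R S b)
         \<longleftrightarrow> (\<exists>r\<in>S. \<exists>s\<in>S. \<exists>t\<in>S. c \<otimes> r = a \<otimes> s \<oplus> b \<otimes> t)"
    (is "?sum \<longleftrightarrow> ?eq")
proof
  assume ?sum
  then obtain a' b' c' r s t
    where a': "a' \<in> marshall_class R S a" and b': "b' \<in> marshall_class R S b"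
      and c': "c' \<in> carrier R" "marshall_class R S c' = marshall_class R S c"
      and rst: "r \<in> S" "s \<in> S" "t \<in> S" and eq: "c' \<otimes> r = a' \<otimes> s \<oplus> b' \<otimes> t"
    by (auto simp: marshall_quotient_def)
  obtain x y z where xyz: "x \<in> S" "y \<in> S" "z \<in> S"
    and rep: "a' = a \<otimes> x" "b' = b \<otimes> y" "c' = c \<otimes> z"
    using a' b' c' S abc by (auto simp: mem_marshall_class_iff marshall_class_eq_iff)
  have "S \<subseteq> carrier R"
    using subset_Units_of_subgroup[OF S] Units_closed by auto
  then have "c \<otimes> (z \<otimes> r) = a \<otimes> (x \<otimes> s) \<oplus> b \<otimes> (y \<otimes> t)"
    using eq rep xyz rst abc by (simp add: m_assoc subset_iff)
  then show ?eq
    using xyz rst unit_subgroup_mult[OF S] by blast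
next
  assume ?eq
  moreover have "a \<in> marshall_class R S a" "b \<in> marshall_class R S b"
    using equiv_class_self[OF equiv_marshall_rel[OF S]] abc
    by (simp_all add: marshall_class_def)
  ultimately show ?sum
    using abc by (simp add: marshall_quotient_def) blast
qed

end

theorem lemma3p2:
  fixes n :: nat and a b c :: "int set"
  assumes "n \<ge> 1"
    and "a \<in> carrier (Zn n)" and "b \<in> carrier (Zn n)" and "c \<in> carrier (Zn n)"
  shows "(Mclass n a = Mclass n b \<longleftrightarrow>
           (\<exists>u\<in>Units (Zn n). a = b \<otimes>\<^bsub>Zn n\<^esub> u [^]\<^bsub>Zn n\<^esub> (2::nat))) \<and>
         (Mclass n c \<in> madd (M n) (Mclass n a) (Mclass n b) \<longleftrightarrow>
           (\<exists>u\<in>Units (Zn n). \<exists>v\<in>Units (Zn n). \<exists>w\<in>Units (Zn n).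
              c \<otimes>\<^bsub>Zn n\<^esub> w [^]\<^bsub>Zn n\<^esub> (2::nat) =
              a \<otimes>\<^bsub>Zn n\<^esub> u [^]\<^bsub>Zn n\<^esub> (2::nat) \<oplus>\<^bsub>Zn n\<^esub> b \<otimes>\<^bsub>Zn n\<^esub> v [^]\<^bsub>Zn n\<^esub> (2::nat)))"
proof -
  interpret cring "Zn n"
    by (rule ZFact_is_cring)
  show ?thesis
    using assms marshall_class_eq_iff[OF subgroup_unit_squares, of a b]
      marshall_class_in_madd_iff[OF subgroup_unit_squares, of a b c]
    by (auto simp: unit_squares_def; blast)
qed

end
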